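(* Let $\theta\in\mathbb{R}$ with $\theta\ge 1$, and let $\Delta=ABC$ be the (possibly degenerate) isosceles triangle with $AB=AC=\theta$ and $BC=2$. Let $\Phi=\sqrt{\theta^2-1}$ be its main altitude (the distance from $A$ to the line $BC$). Then there exists a point $M$ in the plane of $\Delta$ such that $MA$, $MB$, $MC$ are all rational numbers if and only if $$\Phi=\pm\sqrt{(p^2-1)(1-q^2)}\pm\sqrt{r^2-p^2q^2}$$ for some rational numbers $p,q,r$ with $p\ge 1\ge q\ge 0$ and $r\ge pq$, and some choice of the two signs for which the right-hand side is nonnegative. *)

theory Defs
  imports "HOL-Analysis.Analysis"
begin

lemma main_altitude_eq:
  fixes \<theta> :: real and A B C :: "real ^ 2"
  assumes "dist A B = \<theta>" "dist A C = \<theta>" "dist B C = 2"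
  shows "infdist A (affine hull {B, C}) = sqrt (\<theta>\<^sup>2 - 1)"
proof -
  define N where "N = midpoint B C"
  have pyth: "(dist A (B + t *\<^sub>R (C - B)))\<^sup>2 = \<theta>\<^sup>2 - 1 + (2 * t - 1)\<^sup>2" for t
  proof -
    define u v where "u = A - B" and "v = C - B"
    have uu: "u \<bullet> u = \<theta>\<^sup>2"
      using assms(1) by (simp add: u_def dist_norm flip: power2_norm_eq_inner)
    have vv: "v \<bullet> v = 4"
      using assms(3) by (simp add: v_def dist_norm norm_minus_commute flip: power2_norm_eq_inner)
    have "(u - v) \<bullet> (u - v) = \<theta>\<^sup>2"
      using assms(2) by (simp add: u_def v_def dist_norm flip: power2_norm_eq_inner)
    then have uv: "u \<bullet> v = 2"
      using uu vv by (simp add: inner_diff_left inner_diff_right inner_commute)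
    have "(dist A (B + t *\<^sub>R (C - B)))\<^sup>2 = (u - t *\<^sub>R v) \<bullet> (u - t *\<^sub>R v)"
      by (simp add: dist_norm power2_norm_eq_inner u_def v_def algebra_simps)
    also have "\<dots> = u \<bullet> u - 2 * t * (u \<bullet> v) + t * t * (v \<bullet> v)"
      by (simp add: inner_diff_left inner_diff_right inner_commute algebra_simps)
    also have "\<dots> = \<theta>\<^sup>2 - 1 + (2 * t - 1)\<^sup>2"
      by (simp add: uu uv vv power2_eq_square algebra_simps)
    finally show ?thesis .
  qed
  have hull: "affine hull {B, C} = range (\<lambda>t. B + t *\<^sub>R (C - B))"
    unfolding affine_hull_2_alt by simp
  have NB: "N = B + (1/2) *\<^sub>R (C - B)"
  proof -
    have "B + (1/2) *\<^sub>R (C - B) = (1 - 1/2) *\<^sub>R B + (1/2) *\<^sub>R C"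
      by (simp only: scaleR_diff_left scaleR_diff_right scaleR_one) (simp add: algebra_simps)
    then show ?thesis by (simp add: N_def midpoint_def scaleR_right_distrib)
  qed
  have dN: "(dist A N)\<^sup>2 = \<theta>\<^sup>2 - 1"
    using pyth[of "1/2"] unfolding NB by simp
  have "infdist A (affine hull {B, C}) = dist A N"
  proof (rule antisym)
    show "infdist A (affine hull {B, C}) \<le> dist A N"
      by (rule infdist_le) (auto simp: hull NB)
    have "dist A N \<le> dist A x" if "x \<in> affine hull {B, C}" for x
    proof -
      obtain t where x: "x = B + t *\<^sub>R (C - B)" using \<open>x \<in> _\<close> hull by auto
      have "(dist A N)\<^sup>2 \<le> (dist A x)\<^sup>2" unfolding dN x pyth by simp
      then show ?thesis by (rule power2_le_imp_le) simp
    qed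
    then show "dist A N \<le> infdist A (affine hull {B, C})"
      by (auto simp: infdist_def intro!: cINF_greatest)
  qed
  also have "\<dots> = sqrt (\<theta>\<^sup>2 - 1)"
    using dN by (metis real_sqrt_abs abs_of_nonneg zero_le_dist)
  finally show ?thesis .
qed

end

theory Submission
  imports Defs
begin

text \<open>Put \<open>B = (-1, 0)\<close>, \<open>C = (1, 0)\<close>, \<open>A = (0, \<Phi>)\<close>, \<open>M = (x, y)\<close>, and write
  \<open>MB = p + q\<close>, \<open>MC = p - q\<close>. Then \<open>MB\<^sup>2 - MC\<^sup>2 = 4x\<close> gives \<open>x = p q\<close>, hence
  \<open>y\<^sup>2 = (p + q)\<^sup>2 - (p q + 1)\<^sup>2 = (p\<^sup>2 - 1) (1 - q\<^sup>2)\<close>, and \<open>MA = r\<close> amounts to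
  \<open>\<Phi> = y \<plusminus> sqrt (r\<^sup>2 - p\<^sup>2 q\<^sup>2)\<close>. The triangle inequality for \<open>M B C\<close> gives
  \<open>p \<ge> 1\<close> and \<open>\<bar>q\<bar> \<le> 1\<close>; reflecting \<open>M\<close> in the main altitude makes \<open>q \<ge> 0\<close>.\<close>

text \<open>\<open>w\<close> is the quarter turn of \<open>u\<close>, negated if needed to make
  \<open>a\<close> a nonnegative multiple of it. Normalising \<open>a\<close> itself would fail for
  \<open>a = 0\<close>, which is the degenerate triangle.\<close>

lemma orthonormal_frame_real2:
  fixes u a :: "real ^ 2"
  assumes "u \<bullet> u = 1" "u \<bullet> a = 0"
  obtains w where "w \<bullet> w = 1" "u \<bullet> w = 0" "a = norm a *\<^sub>R w"
    "\<And>v. v = (v \<bullet> u) *\<^sub>R u + (v \<bullet> w) *\<^sub>R w"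
proof -
  define w :: "real ^ 2" where "w = vector [- u $ 2, u $ 1]"
  have u1: "u $ 1 * u $ 1 + u $ 2 * u $ 2 = 1"
    using assms(1) by (simp add: inner_vec_def sum_2)
  have ww: "w \<bullet> w = 1" and uw: "u \<bullet> w = 0"
    using u1 by (simp_all add: w_def inner_vec_def sum_2)
  have expand: "v = (v \<bullet> u) *\<^sub>R u + (v \<bullet> w) *\<^sub>R w" for v
  proof -
    have "v $ 1 = (v $ 1 * u $ 1 + v $ 2 * u $ 2) * u $ 1 + (v $ 2 * u $ 1 - v $ 1 * u $ 2) * - u $ 2"
      "v $ 2 = (v $ 1 * u $ 1 + v $ 2 * u $ 2) * u $ 2 + (v $ 2 * u $ 1 - v $ 1 * u $ 2) * u $ 1"
      using u1 by algebra+
    then show ?thesis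
      by (simp add: w_def vec_eq_iff forall_2 inner_vec_def sum_2)
  qed
  have a: "a = (a \<bullet> w) *\<^sub>R w"
    using expand[of a] assms(2) by (simp add: inner_commute)
  have "norm w = 1"
    using ww by (simp add: norm_eq_1)
  then have na: "norm a = \<bar>a \<bullet> w\<bar>"
    by (subst a) simp
  show thesis
  proof (cases "a \<bullet> w \<ge> 0")
    case True
    then show thesis
      using that[of w] ww uw expand a na by simp
  next
    case False
    then show thesis
      using that[of "- w"] ww uw expand a na by simp
  qed
qed

text \<open>Cartesian coordinates adapted to the triangle: the origin is the midpoint of
  \<open>B\<close> and \<open>C\<close>, and the second axis points along the altitude towards
  \<open>A\<close>. Surjectivity and the distance formula are all that is used about
  \<open>P\<close> later.\<close>

lemma isosceles_coordinates:
  fixes \<theta> :: real and A B C :: "real ^ 2"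
  assumes "dist A B = \<theta>" "dist A C = \<theta>" "dist B C = 2"
  obtains P :: "real \<Rightarrow> real \<Rightarrow> real ^ 2" where
    "\<And>M. \<exists>x y. M = P x y"
    "A = P 0 (sqrt (\<theta>\<^sup>2 - 1))" "B = P (- 1) 0" "C = P 1 0"
    "\<And>x y x' y'. (dist (P x y) (P x' y'))\<^sup>2 = (x - x')\<^sup>2 + (y - y')\<^sup>2"
proof -
  define N where "N = midpoint B C"
  define u where "u = (1/2) *\<^sub>R (C - B)"
  define a where "a = A - N"
  have B: "B = N - u" and C: "C = N + u"
    by (simp_all add: N_def u_def midpoint_def vec_eq_iff field_simps)
  have uu: "u \<bullet> u = 1"
    using assms(3) by (simp add: u_def dist_norm norm_minus_commute dot_square_norm)
  have "(a + u) \<bullet> (a + u) = \<theta>\<^sup>2" "(a - u) \<bullet> (a - u) = \<theta>\<^sup>2"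
    using assms(1,2) by (simp_all add: a_def B C dist_norm algebra_simps flip: power2_norm_eq_inner)
  \<comment> \<open>The difference of the two expansions is \<open>4 * (u \<bullet> a)\<close>;
    their sum then gives \<open>a \<bullet> a\<close>.\<close>
  then have ua: "u \<bullet> a = 0" and aa: "a \<bullet> a = \<theta>\<^sup>2 - 1"
    using uu by (simp_all add: inner_diff_left inner_diff_right inner_add_left inner_add_right inner_commute)
  obtain w where w: "w \<bullet> w = 1" "u \<bullet> w = 0" "a = norm a *\<^sub>R w"
    and expand: "\<And>v. v = (v \<bullet> u) *\<^sub>R u + (v \<bullet> w) *\<^sub>R w"
    using orthonormal_frame_real2[OF uu ua] by blast
  have na: "norm a = sqrt (\<theta>\<^sup>2 - 1)"
    by (simp add: norm_eq_sqrt_inner aa)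
  define P where "P x y = N + x *\<^sub>R u + y *\<^sub>R w" for x y
  show thesis
  proof (rule that[of P])
    fix M
    have "M = P ((M - N) \<bullet> u) ((M - N) \<bullet> w)"
      using expand[of "M - N"] by (simp add: P_def algebra_simps)
    then show "\<exists>x y. M = P x y" by blast
  next
    show "A = P 0 (sqrt (\<theta>\<^sup>2 - 1))"
      using w(3) unfolding na by (simp add: P_def a_def algebra_simps)
    show "B = P (- 1) 0" "C = P 1 0"
      by (simp_all add: P_def B C)
  next
    fix x y x' y'
    have "P x y - P x' y' = (x - x') *\<^sub>R u + (y - y') *\<^sub>R w"
      by (simp add: P_def algebra_simps)
    then show "(dist (P x y) (P x' y'))\<^sup>2 = (x - x')\<^sup>2 + (y - y')\<^sup>2"
      using uu w(1,2)
      by (simp add: dist_norm power2_norm_eq_inner inner_add_left inner_add_right inner_commute)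
         (simp add: power2_eq_square)
  qed
qed

lemma eq_signed_sqrt:
  fixes x z :: real
  assumes "x\<^sup>2 = z"
  shows "\<exists>s\<in>{1, -1}. x = s * sqrt z"
  using assms by (cases "x \<ge> 0") (auto simp: real_sqrt_unique)

lemma bifocal_coordinates:
  fixes x y p q :: real
  assumes "(x + 1)\<^sup>2 + y\<^sup>2 = (p + q)\<^sup>2" "(x - 1)\<^sup>2 + y\<^sup>2 = (p - q)\<^sup>2"
  shows "x = p * q" "y\<^sup>2 = (p\<^sup>2 - 1) * (1 - q\<^sup>2)"
proof -
  show "x = p * q"
    using assms by (simp add: power2_eq_square algebra_simps)
  then show "y\<^sup>2 = (p\<^sup>2 - 1) * (1 - q\<^sup>2)"
    using assms(1) by (simp add: power2_eq_square algebra_simps)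
qed

theorem theorem1p2:
  fixes \<theta> \<Phi> :: real and A B C :: "real ^ 2"
  assumes "\<theta> \<ge> 1"
    and "dist A B = \<theta>" and "dist A C = \<theta>" and "dist B C = 2"
    and "\<Phi> = sqrt (\<theta>\<^sup>2 - 1)"
  shows "(\<exists>M :: real ^ 2. dist M A \<in> \<rat> \<and> dist M B \<in> \<rat> \<and> dist M C \<in> \<rat>) \<longleftrightarrow>
    (\<exists>p\<in>\<rat>. \<exists>q\<in>\<rat>. \<exists>r\<in>\<rat>. p \<ge> 1 \<and> 1 \<ge> q \<and> q \<ge> 0 \<and> r \<ge> p * q \<and>
      (\<exists>s\<in>{1, -1}. \<exists>t\<in>{1, -1}.
        s * sqrt ((p\<^sup>2 - 1) * (1 - q\<^sup>2)) + t * sqrt (r\<^sup>2 - p\<^sup>2 * q\<^sup>2) \<ge> 0 \<and>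
        \<Phi> = s * sqrt ((p\<^sup>2 - 1) * (1 - q\<^sup>2)) + t * sqrt (r\<^sup>2 - p\<^sup>2 * q\<^sup>2)))"
proof -
  obtain P :: "real \<Rightarrow> real \<Rightarrow> real ^ 2" where
    surj: "\<And>M. \<exists>x y. M = P x y" and
    A: "A = P 0 \<Phi>" and B: "B = P (- 1) 0" and C: "C = P 1 0" and
    d: "\<And>x y x' y'. (dist (P x y) (P x' y'))\<^sup>2 = (x - x')\<^sup>2 + (y - y')\<^sup>2"
    using isosceles_coordinates[OF assms(2-4)] unfolding assms(5) by metis
  have nonneg: "\<Phi> \<ge> 0"
    using assms(1) by (simp add: assms(5))
  show ?thesis
  proof (intro iffI; elim exE bexE conjE)
    fix M :: "real ^ 2"
    assume rat: "dist M A \<in> \<rat>" "dist M B \<in> \<rat>" "dist M C \<in> \<rat>"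
    obtain x y where M: "M = P x y"
      using surj by blast
    define p q r where "p = (dist M B + dist M C) / 2"
      and "q = (dist M B - dist M C) / 2" and "r = dist M A"
    have "dist M B = p + q" "dist M C = p - q"
      by (simp_all add: p_def q_def field_simps)
    \<comment> \<open>Only the square of \<open>q\<close> enters from here on, so passing to
      \<open>\<bar>q\<bar>\<close> stands in for the reflection of \<open>M\<close>.\<close>
    then have x: "x = p * q" and y: "y\<^sup>2 = (p\<^sup>2 - 1) * (1 - \<bar>q\<bar>\<^sup>2)"
      using bifocal_coordinates[of x y p q] d[of x y "- 1" 0] d[of x y 1 0]
      by (simp_all add: M B C)
    \<comment> \<open>The side \<open>B C\<close> has length 2, so \<open>MB + MC\<close> is at
      least 2 and \<open>MB - MC\<close> lies between -2 and 2.\<close>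
    have p: "p \<ge> 1" and q: "\<bar>q\<bar> \<le> 1"
      using dist_triangle3[of B C M] dist_triangle[of M B C] dist_triangle[of M C B] assms(4)
      by (auto simp: p_def q_def dist_commute abs_le_iff)
    have r: "r\<^sup>2 = x\<^sup>2 + (\<Phi> - y)\<^sup>2"
      using d[of x y 0 \<Phi>] by (simp add: r_def M A power2_commute)
    then have "\<bar>x\<bar> \<le> r"
      by (intro abs_le_square_iff[of x r, THEN iffD2, THEN order_trans]) (auto simp: r_def)
    then have pqr: "p * \<bar>q\<bar> \<le> r"
      using p by (simp add: x abs_mult)
    have "(\<Phi> - y)\<^sup>2 = r\<^sup>2 - p\<^sup>2 * \<bar>q\<bar>\<^sup>2"
      using r by (simp add: x power_mult_distrib)
    from eq_signed_sqrt[OF this] obtain t where t: "t \<in> {1, -1}" "\<Phi> - y = t * sqrt (r\<^sup>2 - p\<^sup>2 * \<bar>q\<bar>\<^sup>2)"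
      by blast
    from eq_signed_sqrt[OF y] obtain s where s: "s \<in> {1, -1}" "y = s * sqrt ((p\<^sup>2 - 1) * (1 - \<bar>q\<bar>\<^sup>2))"
      by blast
    have \<Phi>: "\<Phi> = s * sqrt ((p\<^sup>2 - 1) * (1 - \<bar>q\<bar>\<^sup>2)) + t * sqrt (r\<^sup>2 - p\<^sup>2 * \<bar>q\<bar>\<^sup>2)"
      using s(2) t(2) by linarith
    have "p \<in> \<rat>" "\<bar>q\<bar> \<in> \<rat>" "r \<in> \<rat>"
      using rat by (auto simp: p_def q_def r_def)
    then show "\<exists>p\<in>\<rat>. \<exists>q\<in>\<rat>. \<exists>r\<in>\<rat>. p \<ge> 1 \<and> 1 \<ge> q \<and> q \<ge> 0 \<and> r \<ge> p * q \<and>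
      (\<exists>s\<in>{1, -1}. \<exists>t\<in>{1, -1}.
        s * sqrt ((p\<^sup>2 - 1) * (1 - q\<^sup>2)) + t * sqrt (r\<^sup>2 - p\<^sup>2 * q\<^sup>2) \<ge> 0 \<and>
        \<Phi> = s * sqrt ((p\<^sup>2 - 1) * (1 - q\<^sup>2)) + t * sqrt (r\<^sup>2 - p\<^sup>2 * q\<^sup>2))"
      using p q pqr s(1) t(1) \<Phi> nonneg abs_ge_zero[of q] by metis
  next
    fix p q r s t :: real
    assume rat: "p \<in> \<rat>" "q \<in> \<rat>" "r \<in> \<rat>"
      and pqr: "1 \<le> p" "q \<le> 1" "0 \<le> q" "p * q \<le> r"
      and st: "s \<in> {1, -1}" "t \<in> {1, -1}"
      and \<Phi>: "\<Phi> = s * sqrt ((p\<^sup>2 - 1) * (1 - q\<^sup>2)) + t * sqrt (r\<^sup>2 - p\<^sup>2 * q\<^sup>2)"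
    \<comment> \<open>The first signed root is the height of \<open>M\<close> above
      \<open>B C\<close>, so the second is the height of \<open>A\<close> relative to
      \<open>M\<close>.\<close>
    define y where "y = s * sqrt ((p\<^sup>2 - 1) * (1 - q\<^sup>2))"
    define M where "M = P (p * q) y"
    have pq: "0 \<le> p * q"
      using pqr by simp
    \<comment> \<open>\<open>sqrt\<close> is odd on the reals, so squaring it returns the radicand
      only when that is nonnegative. The second radicand needs the same check, which comes from
      \<open>p * q \<le> r\<close>.\<close>
    have "0 \<le> (p\<^sup>2 - 1) * (1 - q\<^sup>2)"
      using pqr by (intro mult_nonneg_nonneg) (simp_all add: power_le_one)
    then have y2: "y\<^sup>2 = (p\<^sup>2 - 1) * (1 - q\<^sup>2)"
      using st by (auto simp: y_def)
    have "p\<^sup>2 * q\<^sup>2 \<le> r\<^sup>2"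
      using power_mono[OF pqr(4) pq, of 2] by (simp add: power_mult_distrib)
    then have "(\<Phi> - y)\<^sup>2 = r\<^sup>2 - p\<^sup>2 * q\<^sup>2"
      using st by (auto simp: \<Phi> y_def)
    then have "(dist M A)\<^sup>2 = r\<^sup>2"
      by (simp add: M_def A d power_mult_distrib power2_commute[of y])
    moreover have "(dist M B)\<^sup>2 = (p + q)\<^sup>2" "(dist M C)\<^sup>2 = (p - q)\<^sup>2"
      by (simp_all add: M_def B C d y2) (simp_all add: power2_eq_square algebra_simps)
    \<comment> \<open>Squares determine the distances because \<open>r\<close>, \<open>p + q\<close>
      and \<open>p - q\<close> are nonnegative: \<open>0 \<le> p * q \<le> r\<close> and
      \<open>0 \<le> q \<le> 1 \<le> p\<close>.\<close>
    ultimately have "dist M A = r" "dist M B = p + q" "dist M C = p - q"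
      using pqr pq by (simp_all add: power2_eq_iff_nonneg)
    then show "\<exists>M :: real ^ 2. dist M A \<in> \<rat> \<and> dist M B \<in> \<rat> \<and> dist M C \<in> \<rat>"
      using rat by (intro exI[of _ M]) simp
  qed
qed

end
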